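(* For all integers $n\ge1$ and $m\ge1$, $$I_{n-1,m}^{\dagger}\,\hat E_{n,m}\,(\Gamma^1_{n-1,m})^{T}=(\mathcal K^1_{n,m})^{T}A_{n,m-1}^{T}-\tilde\Gamma_{n-1,m}^{\dagger}(\mathcal K^1_{n-1,m})^{T}$$ and $$\tilde I_{n,m-1}^{\dagger}\,\hat{\tilde E}_{n,m}\,(\tilde\Gamma^1_{n,m-1})^{T}=(\tilde{\mathcal K}^1_{n,m})^{T}\tilde A_{n-1,m}^{T}-\Gamma_{n,m-1}^{\dagger}(\tilde{\mathcal K}^1_{n,m-1})^{T}.$$
   Context: Let $\sigma$ be a positive Borel measure on the bi-circle $\mathbb T^2=\{(z,w):|z|=|w|=1\}$ such that for all $n,m\ge0$ the moment (Gram) matrix of the monomials $z^iw^j$, $0\le i\le n$, $0\le j\le m$, in $L^2(\sigma)$ is positive definite. Orthonormal polynomials. For $n,m\ge 0$ and $0\le l\le m$, $\phi^l_{n,m}(z,w)$ is the unique polynomial in the span of the monomials $z^iw^j$ with ($0\le i<n$, $0\le j\le m$) or ($i=n$, $0\le j\le l$), with positive coefficient of $z^nw^l$, of norm $1$ in $L^2(\sigma)$, and orthogonal in $L^2(\sigma)$ to $z^iw^j$ for ($0\le i<n$, $0\le j\le m$) and for ($i=n$, $0\le j<l$). For $0\le l\le n$, $\tilde\phi^l_{n,m}(z,w)$ is defined in the same way with the roles of $z$ and $w$ (and of $n$ and $m$) interchanged: it lies in the span of $z^iw^j$ with ($0\le j<m$, $0\le i\le n$) or ($j=m$, $0\le i\le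 l$), has positive coefficient of $z^lw^m$, has norm $1$, and is orthogonal to $z^iw^j$ for ($0\le j<m$, $0\le i\le n$) and for ($j=m$, $0\le i<l$). Put the column vectors $\Phi_{n,m}=[\phi^m_{n,m},\phi^{m-1}_{n,m},\dots,\phi^0_{n,m}]^T$ (length $m+1$) and $\tilde\Phi_{n,m}=[\tilde\phi^n_{n,m},\dots,\tilde\phi^0_{n,m}]^T$ (length $n+1$). Reverses. For an entry $\phi$ of a vector with index $(n,m)$, $\overleftarrow\phi(z,w)=z^nw^m\,\overline{\phi(1/\bar z,1/\bar w)}$. $\overleftarrow\Phi_{n,m}^T$ and $\overleftarrow{\tilde\Phi}_{n,m}^T$ denote the column vectors of the reverses of the entries of $\Phi_{n,m}$ and $\tilde\Phi_{n,m}$ (in the same order). Inner product. For column vectors of polynomials $X,Y$, $\langle X,Y\rangle=\int_{\mathbb T^2}X\,Y^\dagger\,d\sigma$, where $\dagger$ is conjugate transpose and $T$ is transpose. Recurrence coefficients. $\hat E_{n,m}=\langle z\Phi_{n-1,m},\overleftarrow\Phi_{n-1,m}^T\rangle$ and $A_{n,m}=\langle z\Phi_{n-1,m},\Phi_{n,m}\rangle$, of size $(m+1)\times(m+1)$; $\mathcal K^1_{n,m}=\langle w\Phi_{n,m-1},\overleftarrow{\tilde\Phi}_{n-1,m}^T\rangle$, of size $m\times n$; $\Gamma_{n,m}=\langle\Phi_{n,m-1},\Phi_{n,m}\rangle$ and $\Gamma^1_{n,m}=\langle w\Phi_{n,m-1},\Phi_{n,m}\rangle$, of size $m\times(m+1)$;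 $I_{n,m}=\langle\Phi_{n,m},\tilde\Phi_{n,m}\rangle$, of size $(m+1)\times(n+1)$. The tilde versions are obtained by interchanging the roles of $z,w$, of $n,m$, and of tilded and untilded polynomials: $\hat{\tilde E}_{n,m}=\langle w\tilde\Phi_{n,m-1},\overleftarrow{\tilde\Phi}_{n,m-1}^T\rangle$ and $\tilde A_{n,m}=\langle w\tilde\Phi_{n,m-1},\tilde\Phi_{n,m}\rangle$, of size $(n+1)\times(n+1)$; $\tilde{\mathcal K}^1_{n,m}=\langle z\tilde\Phi_{n-1,m},\overleftarrow{\Phi}_{n,m-1}^T\rangle$, of size $n\times m$; $\tilde\Gamma_{n,m}=\langle\tilde\Phi_{n-1,m},\tilde\Phi_{n,m}\rangle$ and $\tilde\Gamma^1_{n,m}=\langle z\tilde\Phi_{n-1,m},\tilde\Phi_{n,m}\rangle$, of size $n\times(n+1)$; $\tilde I_{n,m}=\langle\tilde\Phi_{n,m},\Phi_{n,m}\rangle$, of size $(n+1)\times(m+1)$. Convention: matrices with an index equal to $0$ that makes them empty (e.g. $\mathcal K^1_{0,m}$, of size $m\times 0$) are empty, and products through an empty dimension are zero matrices. *)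

theory Defs
  imports "HOL-Analysis.Analysis" "Jordan_Normal_Form.Schur_Decomposition"
begin

(* Polynomials in (z, w) are handled as functions on pairs of complex numbers.  Matrices and
   vectors are those of Jordan_Normal_Form, whose dimensions may be 0; HOL-Analysis has
   constants of the same names, hence the qualified names Matrix.mat and Matrix.vec. *)

definition bicircle :: "(complex \<times> complex) set" where
  "bicircle = sphere 0 1 \<times> sphere 0 1"

fun monomial :: "nat \<times> nat \<Rightarrow> complex \<times> complex \<Rightarrow> complex" where
  "monomial (i, j) (z, w) = z ^ i * w ^ j"

definition ip ::
  "(complex \<times> complex) measure \<Rightarrow> (complex \<times> complex \<Rightarrow> complex) \<Rightarrow> (complex \<times> complex \<Rightarrow> complex) \<Rightarrow> complex"
where
  "ip \<sigma> f g = (LINT x|\<sigma>. f x * cnj (g x))"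

definition gram :: "(complex \<times> complex) measure \<Rightarrow> nat \<times> nat \<Rightarrow> nat \<times> nat \<Rightarrow> complex" where
  "gram \<sigma> p q = ip \<sigma> (monomial p) (monomial q)"

definition pos_def_on :: "'i set \<Rightarrow> ('i \<Rightarrow> 'i \<Rightarrow> complex) \<Rightarrow> bool" where
  "pos_def_on S G \<longleftrightarrow>
     (\<forall>c. (\<exists>p\<in>S. c p \<noteq> 0) \<longrightarrow>
        (\<Sum>p\<in>S. \<Sum>q\<in>S. c p * G p q * cnj (c q)) \<in> \<real> \<and>
        Re (\<Sum>p\<in>S. \<Sum>q\<in>S. c p * G p q * cnj (c q)) > 0)"

(* S is the set of exponents preceding the leading exponent a.  The coefficients c are determined
   by f, since f is a function on all of C x C. *)
definition is_orthonormal_poly ::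
  "(complex \<times> complex) measure \<Rightarrow> (nat \<times> nat) set \<Rightarrow> nat \<times> nat \<Rightarrow> (complex \<times> complex \<Rightarrow> complex) \<Rightarrow> bool"
where
  "is_orthonormal_poly \<sigma> S a f \<longleftrightarrow>
     (\<exists>c. f = (\<lambda>x. \<Sum>p\<in>insert a S. c p * monomial p x) \<and> c a \<in> \<real> \<and> Re (c a) > 0) \<and>
     ip \<sigma> f f = 1 \<and>
     (\<forall>p\<in>S. ip \<sigma> f (monomial p) = 0)"

(* Existence and uniqueness of the described polynomials follow from positive definiteness
   of the Gram matrices. *)
definition phi :: "(complex \<times> complex) measure \<Rightarrow> nat \<Rightarrow> nat \<Rightarrow> nat \<Rightarrow> complex \<times> complex \<Rightarrow> complex" where
  "phi \<sigma> n m l = (THE f. is_orthonormal_poly \<sigma> ({..<n} \<times> {..m} \<union> {n} \<times> {..<l}) (n, l) f)"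

definition phi_tilde :: "(complex \<times> complex) measure \<Rightarrow> nat \<Rightarrow> nat \<Rightarrow> nat \<Rightarrow> complex \<times> complex \<Rightarrow> complex" where
  "phi_tilde \<sigma> n m l = (THE f. is_orthonormal_poly \<sigma> ({..n} \<times> {..<m} \<union> {..<l} \<times> {m}) (l, m) f)"

type_synonym fvec = "(complex \<times> complex \<Rightarrow> complex) Matrix.vec"

definition Phi :: "(complex \<times> complex) measure \<Rightarrow> nat \<Rightarrow> nat \<Rightarrow> fvec" where
  "Phi \<sigma> n m = Matrix.vec (m + 1) (\<lambda>k. phi \<sigma> n m (m - k))"

definition Phi_tilde :: "(complex \<times> complex) measure \<Rightarrow> nat \<Rightarrow> nat \<Rightarrow> fvec" where
  "Phi_tilde \<sigma> n m = Matrix.vec (n + 1) (\<lambda>k. phi_tilde \<sigma> n m (n - k))"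

definition reverse_poly ::
  "nat \<Rightarrow> nat \<Rightarrow> (complex \<times> complex \<Rightarrow> complex) \<Rightarrow> complex \<times> complex \<Rightarrow> complex"
where
  "reverse_poly n m f = (\<lambda>(z, w). z ^ n * w ^ m * cnj (f (1 / cnj z, 1 / cnj w)))"

definition rev_Phi :: "(complex \<times> complex) measure \<Rightarrow> nat \<Rightarrow> nat \<Rightarrow> fvec" where
  "rev_Phi \<sigma> n m = map_vec (reverse_poly n m) (Phi \<sigma> n m)"

definition rev_Phi_tilde :: "(complex \<times> complex) measure \<Rightarrow> nat \<Rightarrow> nat \<Rightarrow> fvec" where
  "rev_Phi_tilde \<sigma> n m = map_vec (reverse_poly n m) (Phi_tilde \<sigma> n m)"

definition z_mult :: "fvec \<Rightarrow> fvec" where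
  "z_mult = map_vec (\<lambda>f (z, w). z * f (z, w))"

definition w_mult :: "fvec \<Rightarrow> fvec" where
  "w_mult = map_vec (\<lambda>f (z, w). w * f (z, w))"

definition vip :: "(complex \<times> complex) measure \<Rightarrow> fvec \<Rightarrow> fvec \<Rightarrow> complex Matrix.mat" where
  "vip \<sigma> X Y = Matrix.mat (dim_vec X) (dim_vec Y)
     (\<lambda>(i, j). ip \<sigma> (vec_index X i) (vec_index Y j))"

(* Subtraction below is truncated, so an index 0 - 1 would be read as 0.  Where this would give
   a matrix of the wrong size, the empty matrix of the right size is put explicitly.  E_hat and
   A_mat are meaningful for n >= 1 only, E_hat_tilde and A_tilde for m >= 1 only. *)

definition E_hat :: "(complex \<times> complex) measure \<Rightarrow> nat \<Rightarrow> nat \<Rightarrow> complex Matrix.mat" where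
  "E_hat \<sigma> n m = vip \<sigma> (z_mult (Phi \<sigma> (n - 1) m)) (rev_Phi \<sigma> (n - 1) m)"

definition A_mat :: "(complex \<times> complex) measure \<Rightarrow> nat \<Rightarrow> nat \<Rightarrow> complex Matrix.mat" where
  "A_mat \<sigma> n m = vip \<sigma> (z_mult (Phi \<sigma> (n - 1) m)) (Phi \<sigma> n m)"

definition K1 :: "(complex \<times> complex) measure \<Rightarrow> nat \<Rightarrow> nat \<Rightarrow> complex Matrix.mat" where
  "K1 \<sigma> n m = (if n = 0 \<or> m = 0 then 0\<^sub>m m n
     else vip \<sigma> (w_mult (Phi \<sigma> n (m - 1))) (rev_Phi_tilde \<sigma> (n - 1) m))"

definition Gamma_mat :: "(complex \<times> complex) measure \<Rightarrow> nat \<Rightarrow> nat \<Rightarrow> complex Matrix.mat" where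
  "Gamma_mat \<sigma> n m = (if m = 0 then 0\<^sub>m m (m + 1) else vip \<sigma> (Phi \<sigma> n (m - 1)) (Phi \<sigma> n m))"

definition Gamma1 :: "(complex \<times> complex) measure \<Rightarrow> nat \<Rightarrow> nat \<Rightarrow> complex Matrix.mat" where
  "Gamma1 \<sigma> n m = (if m = 0 then 0\<^sub>m m (m + 1) else vip \<sigma> (w_mult (Phi \<sigma> n (m - 1))) (Phi \<sigma> n m))"

definition I_mat :: "(complex \<times> complex) measure \<Rightarrow> nat \<Rightarrow> nat \<Rightarrow> complex Matrix.mat" where
  "I_mat \<sigma> n m = vip \<sigma> (Phi \<sigma> n m) (Phi_tilde \<sigma> n m)"

definition E_hat_tilde :: "(complex \<times> complex) measure \<Rightarrow> nat \<Rightarrow> nat \<Rightarrow> complex Matrix.mat" where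
  "E_hat_tilde \<sigma> n m = vip \<sigma> (w_mult (Phi_tilde \<sigma> n (m - 1))) (rev_Phi_tilde \<sigma> n (m - 1))"

definition A_tilde :: "(complex \<times> complex) measure \<Rightarrow> nat \<Rightarrow> nat \<Rightarrow> complex Matrix.mat" where
  "A_tilde \<sigma> n m = vip \<sigma> (w_mult (Phi_tilde \<sigma> n (m - 1))) (Phi_tilde \<sigma> n m)"

definition K1_tilde :: "(complex \<times> complex) measure \<Rightarrow> nat \<Rightarrow> nat \<Rightarrow> complex Matrix.mat" where
  "K1_tilde \<sigma> n m = (if n = 0 \<or> m = 0 then 0\<^sub>m n m
     else vip \<sigma> (z_mult (Phi_tilde \<sigma> (n - 1) m)) (rev_Phi \<sigma> n (m - 1)))"

definition Gamma_tilde :: "(complex \<times> complex) measure \<Rightarrow> nat \<Rightarrow> nat \<Rightarrow> complex Matrix.mat" where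
  "Gamma_tilde \<sigma> n m = (if n = 0 then 0\<^sub>m n (n + 1)
     else vip \<sigma> (Phi_tilde \<sigma> (n - 1) m) (Phi_tilde \<sigma> n m))"

definition Gamma1_tilde :: "(complex \<times> complex) measure \<Rightarrow> nat \<Rightarrow> nat \<Rightarrow> complex Matrix.mat" where
  "Gamma1_tilde \<sigma> n m = (if n = 0 then 0\<^sub>m n (n + 1)
     else vip \<sigma> (z_mult (Phi_tilde \<sigma> (n - 1) m)) (Phi_tilde \<sigma> n m))"

definition I_mat_tilde :: "(complex \<times> complex) measure \<Rightarrow> nat \<Rightarrow> nat \<Rightarrow> complex Matrix.mat" where
  "I_mat_tilde \<sigma> n m = vip \<sigma> (Phi_tilde \<sigma> n m) (Phi \<sigma> n m)"

end

theory Submission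
  imports Defs
begin

text \<open>Write \<open>N = n - 1\<close> and let \<open>B f g = \<integral> z f g cnj (z^N w^m) d\<sigma>\<close>, a symmetric bilinear form.
  Fix an entry \<open>t\<close> of \<open>\<Phi>\<close>-tilde at \<open>(N, m)\<close> and an entry \<open>\<psi>\<close> of \<open>\<Phi>\<close> at \<open>(N, m - 1)\<close>, and let \<open>P\<close> be
  the orthogonal projection to the span of the entries of \<open>\<Phi>\<close> at \<open>(N, m)\<close>.  The corresponding entry of the
  left-hand side of the first identity is \<open>B (P t) (P (w \<psi>))\<close>, which equals \<open>B (P t) (w \<psi>)\<close> because
  \<open>w \<psi> - P (w \<psi>)\<close> has degree less than \<open>N\<close> in \<open>z\<close>.
  The first product on the right is \<open>B t (w \<psi>)\<close>: expanding \<open>z \<psi>\<close> in the entries of \<open>\<Phi>\<close> at \<open>(n, m - 1)\<close>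
  leaves a remainder of lower degree, which \<open>t\<close> annihilates.  The second product is \<open>B (t - P t) (w \<psi>)\<close>,
  since \<open>t - P t\<close> has degree less than \<open>N\<close> in \<open>z\<close> and is orthogonal to all such polynomials of degree
  less than \<open>m\<close> in \<open>w\<close>, and hence lies in the span of the entries of \<open>\<Phi>\<close>-tilde at \<open>(N - 1, m)\<close>.
  The second identity is the first one for the image of \<open>\<sigma>\<close> under the exchange of \<open>z\<close> and \<open>w\<close>.\<close>

subsection \<open>Polynomials with prescribed exponents\<close>

lemma monomial_eq: "monomial (i, j) = (\<lambda>x. fst x ^ i * snd x ^ j)"
  by (auto simp: fun_eq_iff)

lemma monomial_add: "monomial (p + q) x = monomial p x * monomial q x"
  by (cases p; cases q; cases x) (simp add: power_add)

lemma monomial_swap: "monomial p (prod.swap x) = monomial (prod.swap p) x"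
  by (cases p; cases x) simp

lemma continuous_on_monomial [continuous_intros]: "continuous_on A (monomial p)"
  by (cases p) (auto simp: monomial_eq intro!: continuous_intros)

lemma norm_monomial_bicircle: "x \<in> bicircle \<Longrightarrow> norm (monomial p x) = 1"
  by (cases p; cases x) (simp add: bicircle_def norm_mult norm_power)

lemma monomial_cnj_bicircle: "x \<in> bicircle \<Longrightarrow> monomial p x * cnj (monomial p x) = 1"
  by (metis complex_norm_square norm_monomial_bicircle of_real_1 power_one)

text \<open>For an infinite \<open>S\<close> the sum defaults to 0 and only the zero function is
  left; hence the finiteness assumptions wherever a monomial has to belong to a span.\<close>

definition poly_span :: "(nat \<times> nat) set \<Rightarrow> (complex \<times> complex \<Rightarrow> complex) set" where
  "poly_span S = {f. \<exists>c. f = (\<lambda>x. \<Sum>p\<in>S. c p * monomial p x)}"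

lemma poly_spanE:
  assumes "f \<in> poly_span S"
  obtains c where "f = (\<lambda>x. \<Sum>p\<in>S. c p * monomial p x)"
  using assms by (auto simp: poly_span_def)

lemma poly_span_zero: "(\<lambda>x. 0) \<in> poly_span S"
  unfolding poly_span_def by (intro CollectI exI[of _ "\<lambda>_. 0"]) simp

lemma poly_span_monomial:
  assumes "finite S" "p \<in> S"
  shows "monomial p \<in> poly_span S"
proof -
  have "(\<lambda>x. \<Sum>q\<in>S. (if p = q then 1 else 0) * monomial q x)
      = (\<lambda>x. \<Sum>q\<in>S. if p = q then monomial q x else 0)"
    by (intro ext sum.cong) auto
  then have "monomial p = (\<lambda>x. \<Sum>q\<in>S. (if p = q then 1 else 0) * monomial q x)"
    using assms by simp
  then show ?thesis unfolding poly_span_def by (intro CollectI exI)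
qed

lemma poly_span_add:
  assumes "f \<in> poly_span S" "g \<in> poly_span S"
  shows "(\<lambda>x. f x + g x) \<in> poly_span S"
proof -
  obtain c d where "f = (\<lambda>x. \<Sum>p\<in>S. c p * monomial p x)" "g = (\<lambda>x. \<Sum>p\<in>S. d p * monomial p x)"
    using assms by (auto elim!: poly_spanE)
  then have "(\<lambda>x. f x + g x) = (\<lambda>x. \<Sum>p\<in>S. (c p + d p) * monomial p x)"
    by (simp add: sum.distrib algebra_simps)
  then show ?thesis unfolding poly_span_def by (intro CollectI exI)
qed

lemma poly_span_scale:
  assumes "f \<in> poly_span S"
  shows "(\<lambda>x. a * f x) \<in> poly_span S"
proof -
  obtain c where "f = (\<lambda>x. \<Sum>p\<in>S. c p * monomial p x)"
    using assms by (auto elim!: poly_spanE)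
  then have "(\<lambda>x. a * f x) = (\<lambda>x. \<Sum>p\<in>S. (a * c p) * monomial p x)"
    by (simp add: sum_distrib_left algebra_simps)
  then show ?thesis unfolding poly_span_def by (intro CollectI exI)
qed

lemma poly_span_diff:
  assumes "f \<in> poly_span S" "g \<in> poly_span S"
  shows "(\<lambda>x. f x - g x) \<in> poly_span S"
  using poly_span_add[OF assms(1) poly_span_scale[OF assms(2), of "-1"]] by simp

lemma poly_span_sum:
  assumes "\<And>k. k \<in> A \<Longrightarrow> f k \<in> poly_span S"
  shows "(\<lambda>x. \<Sum>k\<in>A. f k x) \<in> poly_span S"
  using assms
  by (induction A rule: infinite_finite_induct) (auto intro: poly_span_zero poly_span_add)

text \<open>\<open>T\<close> may be any finite set that contains the shifted exponents, so
  multiplication by a monomial and enlargement of the exponent set are one step;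
  \<open>q = 0\<close> gives pure enlargement.\<close>

lemma poly_span_shift:
  assumes "f \<in> poly_span S" "finite T" "\<And>p. p \<in> S \<Longrightarrow> q + p \<in> T"
  shows "(\<lambda>x. monomial q x * f x) \<in> poly_span T"
proof -
  obtain c where c: "f = (\<lambda>x. \<Sum>p\<in>S. c p * monomial p x)"
    using assms by (auto elim!: poly_spanE)
  have "(\<lambda>x. monomial q x * f x) = (\<lambda>x. \<Sum>p\<in>S. c p * monomial (q + p) x)"
    by (simp add: c sum_distrib_left monomial_add algebra_simps)
  also have "\<dots> \<in> poly_span T"
    by (intro poly_span_sum poly_span_scale poly_span_monomial assms)
  finally show ?thesis .
qed

lemma poly_span_mono:
  assumes "f \<in> poly_span S" "finite T" "S \<subseteq> T"
  shows "f \<in> poly_span T"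
  using poly_span_shift[OF assms(1,2), of 0] assms(3)
  by (force simp: monomial_eq zero_prod_def)

lemma poly_span_swap:
  assumes "f \<in> poly_span S"
  shows "f \<circ> prod.swap \<in> poly_span (prod.swap ` S)"
proof -
  obtain c where c: "f = (\<lambda>x. \<Sum>p\<in>S. c p * monomial p x)"
    using assms by (auto elim!: poly_spanE)
  have "f \<circ> prod.swap = (\<lambda>x. \<Sum>p\<in>prod.swap ` S. c (prod.swap p) * monomial p x)"
    by (simp add: c fun_eq_iff sum.reindex monomial_swap)
  then show ?thesis unfolding poly_span_def by (intro CollectI exI)
qed

lemma poly_span_insertD:
  assumes "f \<in> poly_span (insert a S)" "finite S" "a \<notin> S"
  obtains c h where "h \<in> poly_span S" "f = (\<lambda>x. c * monomial a x + h x)"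
proof -
  obtain c where "f = (\<lambda>x. \<Sum>p\<in>insert a S. c p * monomial p x)"
    using assms(1) by (rule poly_spanE)
  then have "f = (\<lambda>x. c a * monomial a x + (\<Sum>p\<in>S. c p * monomial p x))"
    using assms by simp
  then show ?thesis by (intro that) (auto simp: poly_span_def)
qed

lemma continuous_on_poly_span: "f \<in> poly_span S \<Longrightarrow> continuous_on A f"
  by (auto elim!: poly_spanE intro!: continuous_intros)

subsection \<open>Orthogonal projection and orthonormal polynomials\<close>

text \<open>A locale makes the theory available twice, for \<open>\<sigma>\<close> and for its image
  under the exchange of the variables.\<close>

locale bicircle_measure = finite_measure \<sigma> for \<sigma> :: "(complex \<times> complex) measure" +
  assumes sets_eq: "sets \<sigma> = sets (restrict_space borel bicircle)"
    and pos_def: "\<And>a b. pos_def_on ({..a} \<times> {..b}) (gram \<sigma>)"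
begin

section \<open>Integration of continuous functions over the bicircle\<close>

lemma space_eq: "space \<sigma> = bicircle"
  using sets_eq_imp_space_eq[OF sets_eq] by (simp add: space_restrict_space)

lemma compact_bicircle: "compact bicircle"
  unfolding bicircle_def by (intro compact_Times compact_sphere)

lemma measurable_continuous:
  fixes f :: "complex \<times> complex \<Rightarrow> complex"
  assumes "continuous_on bicircle f"
  shows "f \<in> borel_measurable \<sigma>"
  using borel_measurable_continuous_on_restrict[OF assms] measurable_cong_sets[OF sets_eq refl]
  by blast

text \<open>A continuous function is bounded on the compact bicircle, and the measure is finite.
  This supplies the integrability that additivity of \<open>ip\<close> requires.\<close>

lemma integrable_continuous:
  fixes f :: "complex \<times> complex \<Rightarrow> complex"
  assumes "continuous_on bicircle f"
  shows "integrable \<sigma> f"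
proof -
  have "bounded (f ` bicircle)"
    by (intro compact_imp_bounded compact_continuous_image assms compact_bicircle)
  then obtain B where "\<And>x. x \<in> bicircle \<Longrightarrow> norm (f x) \<le> B"
    by (auto simp: bounded_iff)
  then show ?thesis
    by (intro integrable_const_bound[of _ B] measurable_continuous assms AE_I2) (simp add: space_eq)
qed

lemma ip_cong:
  assumes "\<And>x. x \<in> bicircle \<Longrightarrow> f x * cnj (g x) = f' x * cnj (g' x)"
  shows "ip \<sigma> f g = ip \<sigma> f' g'"
  unfolding ip_def by (intro Bochner_Integration.integral_cong refl) (simp add: space_eq assms)

lemma ip_commute: "ip \<sigma> g f = cnj (ip \<sigma> f g)"
proof -
  have "ip \<sigma> g f = (LINT x|\<sigma>. cnj (f x * cnj (g x)))"
    by (simp add: ip_def mult.commute del: Bochner_Integration.integral_cnj)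
  then show ?thesis by (simp only: ip_def Bochner_Integration.integral_cnj)
qed

lemma ip_scale_left: "ip \<sigma> (\<lambda>x. a * f x) h = a * ip \<sigma> f h"
  unfolding ip_def by (simp add: mult.assoc)

lemma ip_scale_right: "ip \<sigma> h (\<lambda>x. a * f x) = cnj a * ip \<sigma> h f"
  using ip_scale_left[of a f h] by (simp add: ip_commute[of h])

lemma ip_add_left:
  assumes "continuous_on bicircle f" "continuous_on bicircle g" "continuous_on bicircle h"
  shows "ip \<sigma> (\<lambda>x. f x + g x) h = ip \<sigma> f h + ip \<sigma> g h"
  unfolding ip_def distrib_right using assms
  by (intro Bochner_Integration.integral_add integrable_continuous continuous_intros)

lemma ip_diff_left:
  assumes "continuous_on bicircle f" "continuous_on bicircle g" "continuous_on bicircle h"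
  shows "ip \<sigma> (\<lambda>x. f x - g x) h = ip \<sigma> f h - ip \<sigma> g h"
  unfolding ip_def left_diff_distrib using assms
  by (intro Bochner_Integration.integral_diff integrable_continuous continuous_intros)

lemma ip_sum_left:
  assumes "\<And>k. k \<in> A \<Longrightarrow> continuous_on bicircle (f k)" "continuous_on bicircle h"
  shows "ip \<sigma> (\<lambda>x. \<Sum>k\<in>A. f k x) h = (\<Sum>k\<in>A. ip \<sigma> (f k) h)"
  unfolding ip_def sum_distrib_right using assms
  by (intro Bochner_Integration.integral_sum integrable_continuous continuous_intros)

lemma ip_sum_right:
  assumes "\<And>k. k \<in> A \<Longrightarrow> continuous_on bicircle (f k)" "continuous_on bicircle h"
  shows "ip \<sigma> h (\<lambda>x. \<Sum>k\<in>A. f k x) = (\<Sum>k\<in>A. ip \<sigma> h (f k))"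
  using ip_sum_left[of A f h] assms by (simp add: ip_commute[of h])

lemma ip_orth_span:
  assumes "g \<in> poly_span S" "\<And>p. p \<in> S \<Longrightarrow> ip \<sigma> f (monomial p) = 0" "continuous_on bicircle f"
  shows "ip \<sigma> f g = 0"
proof -
  obtain c where "g = (\<lambda>x. \<Sum>p\<in>S. c p * monomial p x)"
    using assms by (auto elim!: poly_spanE)
  then show ?thesis
    using assms(2,3) by (simp add: ip_sum_right ip_scale_right continuous_intros)
qed

section \<open>Positivity and Gram-Schmidt orthogonalization\<close>

text \<open>Positive definiteness is given on rectangles of exponents; the coefficients of
  \<open>f\<close> are extended by 0 to a rectangle containing \<open>S\<close>.\<close>

lemma ip_self_pos:
  assumes f: "f = (\<lambda>x. \<Sum>p\<in>S. c p * monomial p x)" and "finite S" "\<exists>p\<in>S. c p \<noteq> 0"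
  shows "ip \<sigma> f f \<in> \<real>" "Re (ip \<sigma> f f) > 0"
proof -
  define a where "a = Max (fst ` S)"
  define b where "b = Max (snd ` S)"
  have sub: "S \<subseteq> {..a} \<times> {..b}"
  proof
    fix p assume "p \<in> S"
    then have "fst p \<le> a" "snd p \<le> b"
      unfolding a_def b_def using \<open>finite S\<close> by auto
    then show "p \<in> {..a} \<times> {..b}" by (cases p) auto
  qed
  define d where "d p = (if p \<in> S then c p else 0)" for p
  let ?T = "{..a} \<times> {..b}"
  have fd: "f = (\<lambda>x. \<Sum>p\<in>?T. d p * monomial p x)"
    unfolding f d_def using sub
    by (intro ext sum.mono_neutral_cong_left) auto
  have "ip \<sigma> f f = (\<Sum>p\<in>?T. \<Sum>q\<in>?T. d p * gram \<sigma> p q * cnj (d q))"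
    unfolding fd gram_def
    by (simp add: ip_sum_left ip_sum_right ip_scale_left ip_scale_right continuous_intros
        sum_distrib_left mult_ac)
  moreover have "\<exists>p\<in>?T. d p \<noteq> 0"
    using assms(3) sub unfolding d_def by auto
  from pos_def[of a b, unfolded pos_def_on_def, rule_format, OF this]
  have "(\<Sum>p\<in>?T. \<Sum>q\<in>?T. d p * gram \<sigma> p q * cnj (d q)) \<in> \<real>"
    "Re (\<Sum>p\<in>?T. \<Sum>q\<in>?T. d p * gram \<sigma> p q * cnj (d q)) > 0" by blast+
  ultimately show "ip \<sigma> f f \<in> \<real>" "Re (ip \<sigma> f f) > 0"
    by simp_all
qed

text \<open>By linearity \<open>f\<close> is orthogonal to itself, and positivity makes every
  coefficient vanish. Hence the equality holds on all of C x C, not merely almost everywhere on the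
  bicircle.\<close>

lemma self_orth_eq_0:
  assumes "f \<in> poly_span S" "finite S" "\<And>p. p \<in> S \<Longrightarrow> ip \<sigma> f (monomial p) = 0"
  shows "f = (\<lambda>x. 0)"
proof -
  obtain c where c: "f = (\<lambda>x. \<Sum>p\<in>S. c p * monomial p x)"
    using assms by (auto elim!: poly_spanE)
  have "ip \<sigma> f f = 0"
    using assms ip_orth_span continuous_on_poly_span by blast
  then have "\<forall>p\<in>S. c p = 0"
    using ip_self_pos(2)[OF c assms(2)] by auto
  then show ?thesis by (simp add: c)
qed

lemma leading_pos:
  assumes "h \<in> poly_span S" "finite S" "a \<notin> S" "c \<noteq> 0"
    and "f = (\<lambda>x. c * monomial a x + h x)"
  shows "ip \<sigma> f f \<in> \<real>" "Re (ip \<sigma> f f) > 0"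
proof -
  obtain d where d: "h = (\<lambda>x. \<Sum>p\<in>S. d p * monomial p x)"
    using assms by (auto elim!: poly_spanE)
  have "(\<Sum>p\<in>S. d p * monomial p x) = (\<Sum>p\<in>S. (d(a := c)) p * monomial p x)" for x
    using assms by (intro sum.cong) auto
  then have "f = (\<lambda>x. \<Sum>p\<in>insert a S. (d(a := c)) p * monomial p x)"
    using assms d by simp
  from ip_self_pos[OF this] assms
  show "ip \<sigma> f f \<in> \<real>" "Re (ip \<sigma> f f) > 0" by auto
qed

text \<open>Gram-Schmidt, one exponent at a time: \<open>q\<close>, the part of the new monomial
  orthogonal to the old ones, has positive norm, and the projection gains the component of
  \<open>f\<close> along \<open>q\<close>.\<close>

lemma projection_exists:
  assumes "finite S" "continuous_on bicircle f"
  shows "\<exists>g\<in>poly_span S. \<forall>p\<in>S. ip \<sigma> (\<lambda>x. f x - g x) (monomial p) = 0"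
  using assms
proof (induction S arbitrary: f rule: finite_induct)
  case empty
  then show ?case using poly_span_zero by blast
next
  case (insert a S)
  obtain h where h: "h \<in> poly_span S"
    "\<And>p. p \<in> S \<Longrightarrow> ip \<sigma> (\<lambda>x. monomial a x - h x) (monomial p) = 0"
    using insert.IH[OF continuous_on_monomial[of _ a]] by blast
  obtain g where g: "g \<in> poly_span S"
    "\<And>p. p \<in> S \<Longrightarrow> ip \<sigma> (\<lambda>x. f x - g x) (monomial p) = 0"
    using insert.IH[OF insert.prems] by blast
  note [continuous_intros] = continuous_on_poly_span[OF h(1)] continuous_on_poly_span[OF g(1)]
    insert.prems
  define q where "q = (\<lambda>x. monomial a x - h x)"
  have cq [continuous_intros]: "continuous_on bicircle q"
    unfolding q_def by (intro continuous_intros)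
  have "q = (\<lambda>x. 1 * monomial a x + -1 * h x)" by (simp add: q_def)
  then have qq: "Re (ip \<sigma> q q) > 0"
    using leading_pos[OF poly_span_scale[OF h(1), of "-1"] insert.hyps, of 1 q] by auto
  then have qq0: "ip \<sigma> q q \<noteq> 0" by auto
  define t where "t = ip \<sigma> f q / ip \<sigma> q q"
  define g' where "g' = (\<lambda>x. g x + t * q x)"
  have ins: "u \<in> poly_span S \<Longrightarrow> u \<in> poly_span (insert a S)" for u
    using poly_span_mono[of u S "insert a S"] insert.hyps by auto
  have "g' \<in> poly_span (insert a S)"
    unfolding g'_def q_def using insert.hyps
    by (intro poly_span_add poly_span_scale poly_span_diff poly_span_monomial ins h g) auto
  moreover have eq: "ip \<sigma> (\<lambda>x. f x - g' x) u = ip \<sigma> (\<lambda>x. f x - g x) u - t * ip \<sigma> q u"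
    if "continuous_on bicircle u" for u
  proof -
    have "(\<lambda>x. f x - g' x) = (\<lambda>x. (f x - g x) - t * q x)" by (simp add: g'_def algebra_simps)
    then show ?thesis
      using that by (simp add: ip_diff_left ip_scale_left continuous_intros)
  qed
  have orthS: "ip \<sigma> (\<lambda>x. f x - g' x) (monomial p) = 0" if "p \<in> S" for p
    using that h(2) g(2) by (simp add: eq continuous_intros q_def)
  have [continuous_intros]: "continuous_on bicircle g'"
    unfolding g'_def by (intro continuous_intros)
  \<comment> \<open>As \<open>g\<close> lies in the old span, it is orthogonal to \<open>q\<close>;
    the choice of \<open>t\<close> then makes \<open>f - g'\<close> orthogonal to
    \<open>q\<close>.\<close>
  have "ip \<sigma> q g = 0"
    using ip_orth_span[OF g(1) _ cq] h(2) by (simp add: q_def)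
  then have "ip \<sigma> g q = 0" by (simp add: ip_commute[of g])
  then have "ip \<sigma> (\<lambda>x. f x - g' x) q = 0"
    using qq0 by (simp add: eq ip_diff_left continuous_intros t_def)
  moreover have "ip \<sigma> (\<lambda>x. f x - g' x) h = 0"
    by (intro ip_orth_span[OF h(1)] orthS continuous_intros)
  \<comment> \<open>This is \<open>monomial a = q + h\<close>, written as a sum over two indices to
    become an instance of \<open>ip_sum_right\<close>.\<close>
  moreover have "monomial a = (\<lambda>x. \<Sum>k\<in>{True, False}. (if k then q else h) x)"
    by (simp add: q_def)
  then have "ip \<sigma> (\<lambda>x. f x - g' x) (monomial a)
      = (\<Sum>k\<in>{True, False}. ip \<sigma> (\<lambda>x. f x - g' x) (if k then q else h))"
    by (simp only:) (intro ip_sum_right; auto intro!: continuous_intros)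
  ultimately have "ip \<sigma> (\<lambda>x. f x - g' x) (monomial a) = 0" by simp
  with orthS \<open>g' \<in> _\<close> show ?case by auto
qed

lemma is_orthonormal_polyD:
  assumes "is_orthonormal_poly \<sigma> S a f" "finite S" "a \<notin> S"
  obtains c h where "c \<in> \<real>" "Re c > 0" "h \<in> poly_span S" "f = (\<lambda>x. c * monomial a x + h x)"
proof -
  obtain c where "f = (\<lambda>x. \<Sum>p\<in>insert a S. c p * monomial p x)" "c a \<in> \<real>" "Re (c a) > 0"
    using assms by (auto simp: is_orthonormal_poly_def)
  then show ?thesis using assms
    by (intro that[of "c a" "\<lambda>x. \<Sum>p\<in>S. c p * monomial p x"]) (auto simp: poly_span_def)
qed

text \<open>The monomial with exponent \<open>a\<close> minus its projection to the span of
  \<open>S\<close> has leading coefficient 1 and positive squared norm \<open>r\<close>; division by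
  the root of \<open>r\<close> normalizes it.\<close>

lemma orthonormal_poly_exists:
  assumes "finite S" "a \<notin> S"
  shows "\<exists>f. is_orthonormal_poly \<sigma> S a f"
proof -
  obtain h where h: "h \<in> poly_span S"
    "\<And>p. p \<in> S \<Longrightarrow> ip \<sigma> (\<lambda>x. monomial a x - h x) (monomial p) = 0"
    using projection_exists[OF assms(1) continuous_on_monomial[of _ a]] by blast
  define q where "q = (\<lambda>x. monomial a x - h x)"
  have "q = (\<lambda>x. 1 * monomial a x + -1 * h x)" by (simp add: q_def)
  note qq = leading_pos[OF poly_span_scale[OF h(1), of "-1"] assms _ this, simplified]
  define r where "r = Re (ip \<sigma> q q)"
  have r: "ip \<sigma> q q = of_real r" "r > 0" using qq by (auto simp: r_def)
  define f where "f = (\<lambda>x. of_real (1 / sqrt r) * q x)"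
  obtain d where d: "h = (\<lambda>x. \<Sum>p\<in>S. d p * monomial p x)"
    using h by (auto elim!: poly_spanE)
  define c where "c p = (if p = a then of_real (1 / sqrt r) else - (of_real (1 / sqrt r) * d p))" for p
  have "(\<Sum>p\<in>S. c p * monomial p x) = (\<Sum>p\<in>S. - (of_real (1 / sqrt r) * d p) * monomial p x)" for x
    unfolding c_def using assms by (intro sum.cong) auto
  then have "f = (\<lambda>x. \<Sum>p\<in>insert a S. c p * monomial p x)"
    using assms
    by (simp add: f_def q_def d c_def sum_negf sum_distrib_left algebra_simps)
  moreover have "c a \<in> \<real>" "Re (c a) > 0" using r by (auto simp: c_def)
  moreover have "ip \<sigma> f f = of_real ((1 / sqrt r) * (1 / sqrt r) * r)"
    unfolding f_def ip_scale_left ip_scale_right r(1)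
    by (simp only: complex_cnj_complex_of_real of_real_mult mult.assoc)
  then have "ip \<sigma> f f = 1" using r by simp
  moreover have "\<forall>p\<in>S. ip \<sigma> f (monomial p) = 0"
    using h(2) unfolding f_def ip_scale_left by (simp add: q_def)
  ultimately show ?thesis unfolding is_orthonormal_poly_def by blast
qed

text \<open>With leading coefficients \<open>c\<close> and \<open>d\<close>, the combination
  \<open>d f - c g\<close> loses its leading term and is orthogonal to the span it lies in, so it is
  0. Thus \<open>f\<close> is a positive multiple of \<open>g\<close>, and the norms fix the factor
  1.\<close>

lemma orthonormal_poly_unique:
  assumes f: "is_orthonormal_poly \<sigma> S a f" and g: "is_orthonormal_poly \<sigma> S a g"
    and S: "finite S" "a \<notin> S"
  shows "f = g"
proof -
  obtain c h where c: "c \<in> \<real>" "Re c > 0" "h \<in> poly_span S" "f = (\<lambda>x. c * monomial a x + h x)"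
    using is_orthonormal_polyD[OF f S] .
  obtain d k where d: "d \<in> \<real>" "Re d > 0" "k \<in> poly_span S" "g = (\<lambda>x. d * monomial a x + k x)"
    using is_orthonormal_polyD[OF g S] .
  note [continuous_intros] = continuous_on_poly_span[OF c(3)] continuous_on_poly_span[OF d(3)]
  have cont: "continuous_on bicircle f" "continuous_on bicircle g"
    unfolding c(4) d(4) by (intro continuous_intros)+
  define r where "r = (\<lambda>x. d * f x - c * g x)"
  have "r = (\<lambda>x. d * h x - c * k x)" by (simp add: r_def c(4) d(4) algebra_simps)
  then have "r \<in> poly_span S" by (simp add: poly_span_diff poly_span_scale c(3) d(3))
  moreover have "ip \<sigma> r (monomial p) = 0" if "p \<in> S" for p
    using that f g unfolding r_def is_orthonormal_poly_def
    by (simp add: ip_diff_left ip_scale_left cont continuous_intros)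
  ultimately have "r = (\<lambda>x. 0)" using S by (intro self_orth_eq_0)
  moreover have "c \<noteq> 0" "d \<noteq> 0" using c d by auto
  moreover define t where "t = Re c / Re d"
  moreover have "c = of_real (Re c)" "d = of_real (Re d)" using c d by auto
  ultimately have ft: "f = (\<lambda>x. of_real t * g x)"
    unfolding r_def fun_eq_iff
    by (metis (no_types, lifting) eq_iff_diff_eq_0 nonzero_mult_div_cancel_left of_real_divide
        times_divide_eq_left)
  then have "ip \<sigma> f f = of_real (t * t) * ip \<sigma> g g"
    by (simp add: ip_scale_left ip_scale_right)
  then have "complex_of_real (t * t) = of_real 1"
    using f g by (simp add: is_orthonormal_poly_def)
  then have "t * t = 1" by (simp only: of_real_eq_iff)
  moreover have "t > 0" using c d by (simp add: t_def)
  ultimately have "t = 1" using square_eq_1_iff[of t] by auto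
  then show ?thesis using ft by simp
qed

section \<open>The polynomials \<open>phi\<close> and expansion in them\<close>

lemma phi_spec:
  "is_orthonormal_poly \<sigma> ({..<n} \<times> {..m} \<union> {n} \<times> {..<l}) (n, l) (phi \<sigma> n m l)"
proof -
  let ?S = "{..<n} \<times> {..m} \<union> {n} \<times> {..<l}"
  have S: "finite ?S" "(n, l) \<notin> ?S" by auto
  obtain f where f: "is_orthonormal_poly \<sigma> ?S (n, l) f"
    using orthonormal_poly_exists[OF S] by blast
  show ?thesis
    unfolding phi_def
    by (rule theI[where P = "is_orthonormal_poly \<sigma> ?S (n, l)", OF f])
      (rule orthonormal_poly_unique[OF _ f S])
qed

lemma phi_in_span:
  assumes "l \<le> m"
  shows "phi \<sigma> n m l \<in> poly_span ({..n} \<times> {..m})"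
proof -
  have "phi \<sigma> n m l \<in> poly_span (insert (n, l) ({..<n} \<times> {..m} \<union> {n} \<times> {..<l}))"
    using phi_spec[of n m l] unfolding is_orthonormal_poly_def poly_span_def by blast
  then show ?thesis
    by (rule poly_span_mono) (use assms in auto)
qed

lemma phi_orth: "p \<in> {..<n} \<times> {..m} \<union> {n} \<times> {..<l} \<Longrightarrow> ip \<sigma> (phi \<sigma> n m l) (monomial p) = 0"
  using phi_spec[of n m l] unfolding is_orthonormal_poly_def by blast

lemma continuous_on_phi [continuous_intros]: "continuous_on A (phi \<sigma> n m l)"
  using phi_spec[of n m l] continuous_on_poly_span
  unfolding is_orthonormal_poly_def poly_span_def by blast

text \<open>Induction on \<open>L\<close> removes the leading terms in \<open>z ^ n\<close> one at a
  time. What is left over has lower degree in \<open>z\<close> and need not vanish.\<close>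

lemma phi_expand_aux:
  assumes "L \<le> Suc m" "f \<in> poly_span ({..<n} \<times> {..m} \<union> {n} \<times> {..<L})"
  shows "(\<lambda>x. f x - (\<Sum>l<L. ip \<sigma> f (phi \<sigma> n m l) * phi \<sigma> n m l x)) \<in> poly_span ({..<n} \<times> {..m})"
  using assms
proof (induction L arbitrary: f)
  case 0
  then show ?case by simp
next
  case (Suc L)
  let ?S = "{..<n} \<times> {..m} \<union> {n} \<times> {..<L}" and ?p = "phi \<sigma> n m"
  have S: "finite ?S" "(n, L) \<notin> ?S" by auto
  have ins: "{..<n} \<times> {..m} \<union> {n} \<times> {..<Suc L} = insert (n, L) ?S" by auto
  obtain c h where h: "h \<in> poly_span ?S" "f = (\<lambda>x. c * monomial (n, L) x + h x)"
    using Suc.prems(2) S unfolding ins by (rule poly_span_insertD)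
  obtain d k where k: "Re d > 0" "k \<in> poly_span ?S" "?p L = (\<lambda>x. d * monomial (n, L) x + k x)"
    using phi_spec[of n m L] S by (rule is_orthonormal_polyD)
  have "d \<noteq> 0" using k by auto
  \<comment> \<open>Subtracting \<open>c / d\<close> times \<open>phi \<sigma> n m L\<close> from
    \<open>f\<close> cancels the leading monomial and leaves \<open>g\<close>.\<close>
  define g where "g = (\<lambda>x. h x + - (c / d) * k x)"
  have g: "g \<in> poly_span ?S" unfolding g_def by (intro poly_span_add poly_span_scale h k)
  note [continuous_intros] = continuous_on_poly_span[OF g]
  have f: "f = (\<lambda>x. c / d * ?p L x + g x)"
    using \<open>d \<noteq> 0\<close> by (simp add: g_def h(2) k(3) fun_eq_iff field_simps)
  have ipf: "ip \<sigma> f u = c / d * ip \<sigma> (?p L) u + ip \<sigma> g u" if "continuous_on bicircle u" for u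
  proof -
    have "ip \<sigma> f u = ip \<sigma> (\<lambda>x. c / d * ?p L x) u + ip \<sigma> g u"
      unfolding f using that by (intro ip_add_left continuous_intros)
    then show ?thesis by (simp only: ip_scale_left)
  qed
  have pL: "ip \<sigma> (?p L) u = 0" if "u \<in> poly_span ?S" for u
    using that by (rule ip_orth_span) (auto intro!: phi_orth continuous_intros)
  have "ip \<sigma> g (?p L) = 0" using pL[OF g] by (simp add: ip_commute[of g])
  moreover have "ip \<sigma> (?p L) (?p L) = 1"
    using phi_spec by (simp add: is_orthonormal_poly_def)
  ultimately have cL: "ip \<sigma> f (?p L) = c / d"
    by (simp add: ipf continuous_on_phi)
  \<comment> \<open>For \<open>l < L\<close> the polynomial with index \<open>l\<close> lies in the
    span to which the one with index \<open>L\<close> is orthogonal, so \<open>f\<close> and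
    \<open>g\<close> have the same coefficient.\<close>
  have cl: "ip \<sigma> f (?p l) = ip \<sigma> g (?p l)" if "l < L" for l
  proof -
    have "?p l \<in> poly_span (insert (n, l) ({..<n} \<times> {..m} \<union> {n} \<times> {..<l}))"
      using phi_spec[of n m l] unfolding is_orthonormal_poly_def poly_span_def by blast
    then have "?p l \<in> poly_span ?S"
      by (rule poly_span_mono) (use that in auto)
    then show ?thesis by (simp add: ipf continuous_on_phi pL)
  qed
  have "(\<lambda>x. f x - (\<Sum>l<Suc L. ip \<sigma> f (?p l) * ?p l x))
      = (\<lambda>x. g x - (\<Sum>l<L. ip \<sigma> g (?p l) * ?p l x))"
  proof
    fix x
    have "f x = c / d * ?p L x + g x" by (simp only: f)
    then show "f x - (\<Sum>l<Suc L. ip \<sigma> f (?p l) * ?p l x) = g x - (\<Sum>l<L. ip \<sigma> g (?p l) * ?p l x)"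
      by (simp add: cL cl)
  qed
  then show ?case using Suc.IH[OF _ g] Suc.prems(1) by simp
qed

lemma phi_expand:
  assumes "f \<in> poly_span ({..n} \<times> {..m})"
  shows "(\<lambda>x. f x - (\<Sum>l\<le>m. ip \<sigma> f (phi \<sigma> n m l) * phi \<sigma> n m l x)) \<in> poly_span ({..<n} \<times> {..m})"
proof -
  have "{..n} \<times> {..m} = {..<n} \<times> {..m} \<union> {n} \<times> {..<Suc m}" by auto
  then show ?thesis
    using phi_expand_aux[of "Suc m" m f n] assms by (simp add: lessThan_Suc_atMost)
qed

end

subsection \<open>Exchanging the variables\<close>

text \<open>The image measure is formed on the measurable space of \<open>\<sigma>\<close> itself,
  which is stable under the exchange because the bicircle is.\<close>

definition swap_measure :: "(complex \<times> complex) measure \<Rightarrow> (complex \<times> complex) measure" where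
  "swap_measure \<sigma> = distr \<sigma> \<sigma> prod.swap"

context bicircle_measure
begin

lemma measurable_swap: "prod.swap \<in> measurable \<sigma> \<sigma>"
proof -
  have "prod.swap \<in> borel_measurable (borel :: (complex \<times> complex) measure)"
    by (intro borel_measurable_continuous_onI continuous_on_swap)
  then have "prod.swap \<in> measurable (restrict_space borel bicircle) (restrict_space borel bicircle)"
    by (rule measurable_restrict_space3) (auto simp: bicircle_def)
  then show ?thesis using measurable_cong_sets[OF sets_eq sets_eq] by blast
qed

text \<open>For measurable \<open>f\<close> this is change of variables. Otherwise neither integrand
  is integrable, because the exchange is a measurable involution, and both integrals take the
  default value 0.\<close>

lemma integral_swap_measure:
  fixes f :: "complex \<times> complex \<Rightarrow> complex"
  shows "integral\<^sup>L (swap_measure \<sigma>) f = (LINT x|\<sigma>. f (prod.swap x))"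
proof (cases "f \<in> borel_measurable \<sigma>")
  case True
  then show ?thesis unfolding swap_measure_def by (intro integral_distr measurable_swap)
next
  case False
  have "\<not> integrable (swap_measure \<sigma>) f"
    using False by (auto simp: swap_measure_def dest!: borel_measurable_integrable)
  moreover have "\<not> integrable \<sigma> (\<lambda>x. f (prod.swap x))"
  proof
    assume "integrable \<sigma> (\<lambda>x. f (prod.swap x))"
    from measurable_compose[OF measurable_swap borel_measurable_integrable[OF this]] False
    show False by simp
  qed
  ultimately show ?thesis by (simp add: not_integrable_integral_eq)
qed

lemma ip_swap: "ip (swap_measure \<sigma>) f g = ip \<sigma> (f \<circ> prod.swap) (g \<circ> prod.swap)"
  by (simp add: ip_def integral_swap_measure)

lemma gram_swap: "gram (swap_measure \<sigma>) p q = gram \<sigma> (prod.swap p) (prod.swap q)"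
  unfolding gram_def ip_swap by (simp add: o_def monomial_swap)

lemma bicircle_measure_swap: "bicircle_measure (swap_measure \<sigma>)"
proof -
  have "finite_measure (swap_measure \<sigma>)"
    unfolding swap_measure_def by (intro finite_measure_distr measurable_swap)
  moreover have "sets (swap_measure \<sigma>) = sets (restrict_space borel bicircle)"
    by (simp add: swap_measure_def sets_eq)
  moreover have "pos_def_on ({..a} \<times> {..b}) (gram (swap_measure \<sigma>))" for a b
    unfolding pos_def_on_def
  proof (intro allI impI)
    fix c :: "nat \<times> nat \<Rightarrow> complex" assume c: "\<exists>p\<in>{..a} \<times> {..b}. c p \<noteq> 0"
    have sum: "sum F ({..b} \<times> {..a}) = (\<Sum>p\<in>{..a} \<times> {..b}. F (prod.swap p))"
      for F :: "nat \<times> nat \<Rightarrow> complex"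
      by (simp only: product_swap[of "{..a}" "{..b}", symmetric] sum.reindex inj_swap o_def)
    have "\<exists>p\<in>{..b} \<times> {..a}. (c \<circ> prod.swap) p \<noteq> 0"
      using c by force
    from pos_def[of b a, unfolded pos_def_on_def, rule_format, OF this]
    show "(\<Sum>p\<in>{..a} \<times> {..b}. \<Sum>q\<in>{..a} \<times> {..b}. c p * gram (swap_measure \<sigma>) p q * cnj (c q)) \<in> \<real> \<and>
      Re (\<Sum>p\<in>{..a} \<times> {..b}. \<Sum>q\<in>{..a} \<times> {..b}. c p * gram (swap_measure \<sigma>) p q * cnj (c q)) > 0"
      by (simp add: sum gram_swap)
  qed
  ultimately show ?thesis
    unfolding bicircle_measure_def bicircle_measure_axioms_def by blast
qed

lemma swap_swap_measure: "swap_measure (swap_measure \<sigma>) = \<sigma>"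
proof -
  \<comment> \<open>The target of the outer image may be replaced by \<open>\<sigma>\<close>, which
    has the same measurable sets.\<close>
  have "swap_measure (swap_measure \<sigma>) = distr (distr \<sigma> \<sigma> prod.swap) \<sigma> prod.swap"
    unfolding swap_measure_def by (rule distr_cong) auto
  also have "\<dots> = distr \<sigma> \<sigma> (\<lambda>x. x)"
    by (simp add: distr_distr measurable_swap o_def)
  finally show ?thesis by simp
qed

lemma is_orthonormal_poly_swap:
  assumes "is_orthonormal_poly (swap_measure \<sigma>) S a f"
  shows "is_orthonormal_poly \<sigma> (prod.swap ` S) (prod.swap a) (f \<circ> prod.swap)"
proof -
  obtain c where c: "f = (\<lambda>x. \<Sum>p\<in>insert a S. c p * monomial p x)" "c a \<in> \<real>" "Re (c a) > 0"
    using assms by (auto simp: is_orthonormal_poly_def)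
  have "f \<circ> prod.swap
      = (\<lambda>x. \<Sum>p\<in>prod.swap ` (insert a S). (c \<circ> prod.swap) p * monomial p x)"
    by (subst sum.reindex)
      (simp_all only: c(1) fun_eq_iff monomial_swap o_apply o_def swap_swap inj_swap refl simp_thms)
  moreover have "f \<circ> prod.swap \<circ> prod.swap = f" by (simp add: fun_eq_iff)
  ultimately show ?thesis
    using assms c(2,3) unfolding is_orthonormal_poly_def
    by (intro conjI exI[of _ "c \<circ> prod.swap"]) (auto simp: ip_swap o_def monomial_swap)
qed

text \<open>Uniqueness identifies the two sides. All facts about \<open>phi_tilde\<close> below come
  from those about \<open>phi\<close> for the swapped measure through this equation.\<close>

lemma phi_tilde_eq: "phi_tilde \<sigma> n m l = phi (swap_measure \<sigma>) m n l \<circ> prod.swap"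
proof -
  interpret swapped: bicircle_measure "swap_measure \<sigma>" by (rule bicircle_measure_swap)
  let ?S = "{..n} \<times> {..<m} \<union> {..<l} \<times> {m}"
  have "is_orthonormal_poly \<sigma> ?S (l, m) (phi (swap_measure \<sigma>) m n l \<circ> prod.swap)"
    using is_orthonormal_poly_swap[OF swapped.phi_spec[of m n l]]
    by (simp only: image_Un product_swap swap_simp image_insert image_empty)
  moreover have "finite ?S" "(l, m) \<notin> ?S" by auto
  ultimately show ?thesis
    unfolding phi_tilde_def by (blast intro: the_equality orthonormal_poly_unique)
qed

lemma continuous_on_phi_tilde [continuous_intros]: "continuous_on A (phi_tilde \<sigma> n m l)"
proof -
  interpret swapped: bicircle_measure "swap_measure \<sigma>" by (rule bicircle_measure_swap)
  show ?thesis
    unfolding phi_tilde_eq by (intro continuous_on_compose continuous_on_swap swapped.continuous_on_phi)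
qed

lemma phi_tilde_in_span:
  assumes "l \<le> n"
  shows "phi_tilde \<sigma> n m l \<in> poly_span ({..n} \<times> {..m})"
proof -
  interpret swapped: bicircle_measure "swap_measure \<sigma>" by (rule bicircle_measure_swap)
  show ?thesis
    using poly_span_swap[OF swapped.phi_in_span[OF assms, of m]] unfolding product_swap
    by (simp add: phi_tilde_eq)
qed

lemma phi_tilde_orth:
  assumes "p \<in> {..n} \<times> {..<m}"
  shows "ip \<sigma> (phi_tilde \<sigma> n m l) (monomial p) = 0"
proof -
  interpret swapped: bicircle_measure "swap_measure \<sigma>" by (rule bicircle_measure_swap)
  have "ip (swap_measure \<sigma>) (phi (swap_measure \<sigma>) m n l) (monomial (prod.swap p)) = 0"
    using assms by (intro swapped.phi_orth) auto
  then show ?thesis by (simp add: ip_swap phi_tilde_eq monomial_swap o_def)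
qed

lemma phi_tilde_expand:
  assumes "f \<in> poly_span ({..n} \<times> {..m})"
  shows "(\<lambda>x. f x - (\<Sum>l\<le>n. ip \<sigma> f (phi_tilde \<sigma> n m l) * phi_tilde \<sigma> n m l x))
    \<in> poly_span ({..n} \<times> {..<m})"
proof -
  interpret swapped: bicircle_measure "swap_measure \<sigma>" by (rule bicircle_measure_swap)
  have "f \<circ> prod.swap \<in> poly_span ({..m} \<times> {..n})"
    using poly_span_swap[OF assms] by (simp only: product_swap)
  from poly_span_swap[OF swapped.phi_expand[OF this]]
  show ?thesis unfolding product_swap by (simp add: phi_tilde_eq ip_swap o_def)
qed

end

subsection \<open>The identity for a single entry\<close>

context bicircle_measure
begin

text \<open>On the bicircle \<open>1 / cnj z = z\<close>, so the conjugate of the reverse of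
  \<open>g\<close> is \<open>g\<close> times a conjugate monomial. Pairing with reverses thus
  becomes a symmetric bilinear form.\<close>

lemma ip_reverse: "ip \<sigma> f (reverse_poly n m g) = ip \<sigma> (\<lambda>x. f x * g x) (monomial (n, m))"
proof (rule ip_cong)
  fix x assume "x \<in> bicircle"
  then have "1 / cnj (fst x) = fst x" "1 / cnj (snd x) = snd x"
    by (auto simp: bicircle_def complex_div_cnj[of 1])
  then show "f x * cnj (reverse_poly n m g x) = f x * g x * cnj (monomial (n, m) x)"
    by (cases x) (simp add: reverse_poly_def)
qed

lemma ip_shift: "ip \<sigma> (\<lambda>x. monomial q x * h x) (monomial (q + p)) = ip \<sigma> h (monomial p)"
proof (rule ip_cong)
  fix x assume "x \<in> bicircle"
  then have "monomial q x * cnj (monomial q x) = 1" by (rule monomial_cnj_bicircle)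
  then show "monomial q x * h x * cnj (monomial (q + p) x) = h x * cnj (monomial p x)"
    by (simp add: monomial_add)
qed

lemma ip_mult_sum:
  assumes "\<And>k. k \<in> A \<Longrightarrow> continuous_on bicircle (f k)"
    "continuous_on bicircle u" "continuous_on bicircle h"
  shows "ip \<sigma> (\<lambda>x. u x * (\<Sum>k\<in>A. c k * f k x)) h = (\<Sum>k\<in>A. c k * ip \<sigma> (\<lambda>x. u x * f k x) h)"
proof -
  have "ip \<sigma> (\<lambda>x. u x * (\<Sum>k\<in>A. c k * f k x)) h = ip \<sigma> (\<lambda>x. \<Sum>k\<in>A. c k * (u x * f k x)) h"
    by (simp add: sum_distrib_left mult_ac)
  also have "\<dots> = (\<Sum>k\<in>A. c k * ip \<sigma> (\<lambda>x. u x * f k x) h)"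
    using assms by (subst ip_sum_left) (auto intro!: continuous_intros simp: ip_scale_left)
  finally show ?thesis .
qed

text \<open>Monomials have modulus 1 on the bicircle, so a term of \<open>g\<close> with exponent
  \<open>p\<close> can be moved to the other side, where it turns \<open>k\<close> into
  \<open>k - p\<close>. It remains that \<open>f\<close> is orthogonal to these complementary
  exponents.\<close>

lemma ip_mult_eq_0:
  assumes "continuous_on bicircle f" "g \<in> poly_span T"
    and "\<And>p. p \<in> S \<Longrightarrow> ip \<sigma> f (monomial p) = 0"
    and "\<And>p. p \<in> T \<Longrightarrow> \<exists>q\<in>S. k = p + q"
  shows "ip \<sigma> (\<lambda>x. f x * g x) (monomial k) = 0"
proof -
  obtain c where c: "g = (\<lambda>x. \<Sum>p\<in>T. c p * monomial p x)"
    using assms(2) by (rule poly_spanE)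
  have "ip \<sigma> (\<lambda>x. f x * monomial p x) (monomial k) = 0" if p: "p \<in> T" for p
  proof -
    obtain q where "q \<in> S" "k = p + q" using assms(4)[OF p] by blast
    then show ?thesis
      using assms(3)[of q] ip_shift[of p f q] by (simp add: mult.commute)
  qed
  then show ?thesis
    unfolding c using assms(1) by (simp add: ip_mult_sum continuous_on_monomial)
qed

text \<open>The sums are the entries of the matrix products, with the polynomials in increasing
  order. Each product is brought to the form \<open>B\<close>. The case \<open>N = 0\<close> stands
  for the empty matrices, where \<open>N - 1\<close> would be truncated to 0.\<close>

lemma entry_identity:
  fixes N M a b :: nat
  defines "t \<equiv> phi_tilde \<sigma> N (Suc M) a" and "\<psi> \<equiv> phi \<sigma> N M b"
    and "\<phi> \<equiv> phi \<sigma> N (Suc M)" and "\<theta> \<equiv> phi \<sigma> (Suc N) M" and "\<eta> \<equiv> phi_tilde \<sigma> (N - 1) (Suc M)"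
    and "z \<equiv> monomial (1, 0)" and "w \<equiv> monomial (0, 1)"
  assumes "a \<le> N" "b \<le> M"
  shows "(\<Sum>j\<le>Suc M. (\<Sum>i\<le>Suc M. cnj (ip \<sigma> (\<phi> i) t)
        * ip \<sigma> (\<lambda>x. z x * \<phi> i x) (reverse_poly N (Suc M) (\<phi> j))) * ip \<sigma> (\<lambda>x. w x * \<psi> x) (\<phi> j))
    = (\<Sum>k\<le>M. ip \<sigma> (\<lambda>x. w x * \<theta> k x) (reverse_poly N (Suc M) t) * ip \<sigma> (\<lambda>x. z x * \<psi> x) (\<theta> k))
      - (if N = 0 then 0 else \<Sum>k\<le>N - 1. cnj (ip \<sigma> (\<eta> k) t)
          * ip \<sigma> (\<lambda>x. w x * \<psi> x) (reverse_poly (N - 1) (Suc M) (\<eta> k)))"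
proof -
  let ?e = "monomial (N, Suc M)"
  have cont [continuous_intros]: "continuous_on bicircle t" "continuous_on bicircle \<psi>"
    "continuous_on bicircle (\<phi> i)" "continuous_on bicircle (\<theta> i)" "continuous_on bicircle (\<eta> i)"
    "continuous_on bicircle z" "continuous_on bicircle w" for i
    unfolding t_def \<psi>_def \<phi>_def \<theta>_def \<eta>_def z_def w_def by (intro continuous_intros)+
  have t: "t \<in> poly_span ({..N} \<times> {..Suc M})"
    unfolding t_def by (intro phi_tilde_in_span assms)
  have t_orth: "ip \<sigma> t (monomial p) = 0" if "p \<in> {..N} \<times> {..<Suc M}" for p
    unfolding t_def using that by (rule phi_tilde_orth)
  have \<psi>: "\<psi> \<in> poly_span ({..N} \<times> {..M})"
    unfolding \<psi>_def by (intro phi_in_span assms)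
  define Pt where "Pt = (\<lambda>x. \<Sum>i\<le>Suc M. ip \<sigma> t (\<phi> i) * \<phi> i x)"
  define Pw where "Pw = (\<lambda>x. \<Sum>j\<le>Suc M. ip \<sigma> (\<lambda>x. w x * \<psi> x) (\<phi> j) * \<phi> j x)"
  define Qz where "Qz = (\<lambda>x. \<Sum>k\<le>M. ip \<sigma> (\<lambda>x. z x * \<psi> x) (\<theta> k) * \<theta> k x)"
  \<comment> \<open>\<open>St\<close> will turn out to be \<open>t - Pt\<close>.\<close>
  define St where "St = (\<lambda>x. if N = 0 then 0 else \<Sum>k\<le>N - 1. ip \<sigma> t (\<eta> k) * \<eta> k x)"
  have [continuous_intros]: "continuous_on bicircle Pt" "continuous_on bicircle Pw"
    "continuous_on bicircle Qz" "continuous_on bicircle St"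
    unfolding Pt_def Pw_def Qz_def St_def by (cases "N = 0"; auto intro!: continuous_intros)+
  have Pt_orth: "ip \<sigma> Pt (monomial p) = 0" if "p \<in> {..<N} \<times> {..Suc M}" for p
  proof -
    have "ip \<sigma> (\<phi> i) (monomial p) = 0" for i
      unfolding \<phi>_def using that by (intro phi_orth) auto
    then show ?thesis
      unfolding Pt_def by (subst ip_sum_left) (auto intro!: continuous_intros simp: ip_scale_left)
  qed

  \<comment> \<open>Replacement of \<open>Pw\<close> by \<open>w \<psi>\<close>: after
    multiplication by \<open>z\<close> the error has \<open>z\<close>-exponents from 1 to
    \<open>N\<close>, whose complements in \<open>N\<close> are below \<open>N\<close>, and there
    \<open>Pt\<close> is orthogonal.\<close>
  have "(\<lambda>x. w x * \<psi> x) \<in> poly_span ({..N} \<times> {..Suc M})"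
    unfolding w_def by (rule poly_span_shift[OF \<psi>]) auto
  from phi_expand[OF this]
  have "(\<lambda>x. w x * \<psi> x - Pw x) \<in> poly_span ({..<N} \<times> {..Suc M})"
    by (simp only: Pw_def \<phi>_def)
  then have "(\<lambda>x. z x * (w x * \<psi> x - Pw x)) \<in> poly_span ({1..N} \<times> {..Suc M})"
    unfolding z_def by (rule poly_span_shift) auto
  then have "ip \<sigma> (\<lambda>x. Pt x * (z x * (w x * \<psi> x - Pw x))) ?e = 0"
  proof (rule ip_mult_eq_0[rotated])
    show "\<exists>q\<in>{..<N} \<times> {..Suc M}. (N, Suc M) = p + q" if "p \<in> {1..N} \<times> {..Suc M}" for p
      using that by (intro bexI[of _ "(N - fst p, Suc M - snd p)"]) (cases p; auto)+
  qed (auto intro!: Pt_orth continuous_intros)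
  moreover have "(\<lambda>x. Pt x * (z x * (w x * \<psi> x - Pw x)))
      = (\<lambda>x. z x * (w x * \<psi> x) * Pt x - z x * Pt x * Pw x)"
    by (simp add: algebra_simps)
  ultimately have 1: "ip \<sigma> (\<lambda>x. z x * Pt x * Pw x) ?e = ip \<sigma> (\<lambda>x. z x * (w x * \<psi> x) * Pt x) ?e"
    by (simp add: ip_diff_left continuous_intros)

  have inner: "ip \<sigma> (\<lambda>x. z x * Pt x * \<phi> j x) ?e
      = (\<Sum>i\<le>Suc M. ip \<sigma> t (\<phi> i) * ip \<sigma> (\<lambda>x. z x * \<phi> i x * \<phi> j x) ?e)" for j
  proof -
    \<comment> \<open>Symmetry of the form lets the sum in \<open>Pt\<close> be expanded as the last
      factor.\<close>
    have "(\<lambda>x. z x * Pt x * \<phi> j x) = (\<lambda>x. z x * \<phi> j x * Pt x)" by (simp add: mult_ac)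
    then have "ip \<sigma> (\<lambda>x. z x * Pt x * \<phi> j x) ?e
      = (\<Sum>i\<le>Suc M. ip \<sigma> t (\<phi> i) * ip \<sigma> (\<lambda>x. z x * \<phi> j x * \<phi> i x) ?e)"
      unfolding Pt_def by (simp only:) (intro ip_mult_sum continuous_intros)
    then show ?thesis by (simp add: mult_ac)
  qed
  have inner': "(\<Sum>i\<le>Suc M. cnj (ip \<sigma> (\<phi> i) t)
        * ip \<sigma> (\<lambda>x. z x * \<phi> i x) (reverse_poly N (Suc M) (\<phi> j)))
      = ip \<sigma> (\<lambda>x. z x * Pt x * \<phi> j x) ?e" for j
    by (simp only: inner ip_reverse ip_commute[of t])
  have "ip \<sigma> (\<lambda>x. z x * Pt x * Pw x) ?e
      = (\<Sum>j\<le>Suc M. ip \<sigma> (\<lambda>x. w x * \<psi> x) (\<phi> j) * ip \<sigma> (\<lambda>x. z x * Pt x * \<phi> j x) ?e)"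
    unfolding Pw_def by (intro ip_mult_sum continuous_intros)
  then have lhs: "(\<Sum>j\<le>Suc M. (\<Sum>i\<le>Suc M. cnj (ip \<sigma> (\<phi> i) t)
        * ip \<sigma> (\<lambda>x. z x * \<phi> i x) (reverse_poly N (Suc M) (\<phi> j))) * ip \<sigma> (\<lambda>x. w x * \<psi> x) (\<phi> j))
      = ip \<sigma> (\<lambda>x. z x * Pt x * Pw x) ?e"
    by (simp only: inner' mult.commute[of "ip \<sigma> (\<lambda>x. w x * \<psi> x) _"])

  \<comment> \<open>Now the roles of the variables differ: the remainder of \<open>z \<psi>\<close>
    is multiplied by \<open>w\<close>, so the complements of its \<open>w\<close>-exponents in
    \<open>Suc M\<close> are at most \<open>M\<close>, and there \<open>t\<close> is
    orthogonal.\<close>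
  have "(\<lambda>x. z x * \<psi> x) \<in> poly_span ({..Suc N} \<times> {..M})"
    unfolding z_def by (rule poly_span_shift[OF \<psi>]) auto
  from phi_expand[OF this]
  have "(\<lambda>x. z x * \<psi> x - Qz x) \<in> poly_span ({..<Suc N} \<times> {..M})"
    by (simp only: Qz_def \<theta>_def)
  then have "(\<lambda>x. w x * (z x * \<psi> x - Qz x)) \<in> poly_span ({..N} \<times> {1..Suc M})"
    unfolding w_def by (rule poly_span_shift) auto
  then have "ip \<sigma> (\<lambda>x. t x * (w x * (z x * \<psi> x - Qz x))) ?e = 0"
  proof (rule ip_mult_eq_0[rotated])
    show "\<exists>q\<in>{..N} \<times> {..<Suc M}. (N, Suc M) = p + q" if "p \<in> {..N} \<times> {1..Suc M}" for p
      using that by (intro bexI[of _ "(N - fst p, Suc M - snd p)"]) (cases p; auto)+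
  qed (auto intro!: t_orth continuous_intros)
  moreover have "(\<lambda>x. t x * (w x * (z x * \<psi> x - Qz x)))
      = (\<lambda>x. z x * (w x * \<psi> x) * t x - w x * t x * Qz x)"
    by (simp add: algebra_simps)
  ultimately have "ip \<sigma> (\<lambda>x. w x * t x * Qz x) ?e = ip \<sigma> (\<lambda>x. z x * (w x * \<psi> x) * t x) ?e"
    by (simp add: ip_diff_left continuous_intros)
  moreover have "ip \<sigma> (\<lambda>x. w x * t x * Qz x) ?e
      = (\<Sum>k\<le>M. ip \<sigma> (\<lambda>x. z x * \<psi> x) (\<theta> k) * ip \<sigma> (\<lambda>x. w x * t x * \<theta> k x) ?e)"
    unfolding Qz_def by (intro ip_mult_sum continuous_intros)
  ultimately have rhs1: "(\<Sum>k\<le>M. ip \<sigma> (\<lambda>x. w x * \<theta> k x) (reverse_poly N (Suc M) t) * ip \<sigma> (\<lambda>x. z x * \<psi> x) (\<theta> k))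
      = ip \<sigma> (\<lambda>x. z x * (w x * \<psi> x) * t x) ?e"
    by (simp add: ip_reverse mult_ac)

  have rhs2: "(if N = 0 then 0 else \<Sum>k\<le>N - 1. cnj (ip \<sigma> (\<eta> k) t)
          * ip \<sigma> (\<lambda>x. w x * \<psi> x) (reverse_poly (N - 1) (Suc M) (\<eta> k)))
      = ip \<sigma> (\<lambda>x. z x * (w x * \<psi> x) * St x) ?e"
  proof (cases "N = 0")
    case True
    then show ?thesis by (simp add: St_def ip_def)
  next
    case False
    \<comment> \<open>The factor \<open>z\<close> cancels against one power in the weight, which
      lowers \<open>N\<close> to \<open>N - 1\<close> and so produces the reverses at the smaller
      index.\<close>
    then have "(N, Suc M) = (1, 0) + (N - 1, Suc M)" by simp
    then have "ip \<sigma> (\<lambda>x. z x * (w x * \<psi> x) * u x) ?e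
        = ip \<sigma> (\<lambda>x. w x * \<psi> x * u x) (monomial (N - 1, Suc M))" for u
      using ip_shift[of "(1, 0)" "\<lambda>x. w x * \<psi> x * u x" "(N - 1, Suc M)"]
      by (simp add: z_def mult.assoc)
    moreover have "ip \<sigma> (\<lambda>x. w x * \<psi> x * (\<Sum>k\<le>N - 1. ip \<sigma> t (\<eta> k) * \<eta> k x)) (monomial (N - 1, Suc M))
        = (\<Sum>k\<le>N - 1. ip \<sigma> t (\<eta> k) * ip \<sigma> (\<lambda>x. w x * \<psi> x * \<eta> k x) (monomial (N - 1, Suc M)))"
      by (intro ip_mult_sum continuous_intros)
    ultimately show ?thesis
      using False by (simp add: ip_reverse St_def ip_commute[of t])
  qed

  have tP: "(\<lambda>x. t x - Pt x) \<in> poly_span ({..<N} \<times> {..Suc M})"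
    using phi_expand[OF t] by (simp only: Pt_def \<phi>_def)
  have "(\<lambda>x. t x - Pt x - St x) = (\<lambda>x. 0)"
  proof (cases "N = 0")
    case True
    then show ?thesis using tP by (auto simp: poly_span_def St_def)
  next
    case False
    have lt: "{..<N} = {..N - 1}" using False by auto
    let ?g = "\<lambda>x. t x - Pt x"
    \<comment> \<open>Each \<open>\<eta> k\<close> has degree below \<open>N\<close> in
      \<open>z\<close>, so \<open>Pt\<close> is orthogonal to it and \<open>t - Pt\<close> has the
      same coefficients as \<open>t\<close>.\<close>
    have "ip \<sigma> Pt (\<eta> k) = 0" if "k \<le> N - 1" for k
    proof (rule ip_orth_span)
      show "\<eta> k \<in> poly_span ({..<N} \<times> {..Suc M})"
        unfolding \<eta>_def lt using that by (rule phi_tilde_in_span)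
    qed (auto intro!: Pt_orth continuous_intros)
    then have c: "ip \<sigma> ?g (\<eta> k) = ip \<sigma> t (\<eta> k)" if "k \<le> N - 1" for k
      using that by (simp add: ip_diff_left continuous_intros)
    have St: "St = (\<lambda>x. \<Sum>k\<le>N - 1. ip \<sigma> ?g (\<eta> k) * \<eta> k x)"
      using False by (simp add: St_def c)
    have "(\<lambda>x. t x - Pt x - St x) \<in> poly_span ({..N - 1} \<times> {..<Suc M})"
      unfolding St \<eta>_def using tP unfolding lt by (rule phi_tilde_expand)
    \<comment> \<open>The difference has degree below \<open>N\<close> in \<open>z\<close> and at
      most \<open>M\<close> in \<open>w\<close>; \<open>t\<close>, \<open>Pt\<close> and
      \<open>St\<close> are all orthogonal to such monomials, so it vanishes.\<close>
    then show ?thesis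
    proof (rule self_orth_eq_0)
      fix p assume p: "p \<in> {..N - 1} \<times> {..<Suc M}"
      have "ip \<sigma> (\<eta> k) (monomial p) = 0" for k
        unfolding \<eta>_def using p by (rule phi_tilde_orth)
      then have "ip \<sigma> St (monomial p) = 0"
        unfolding St by (subst ip_sum_left) (auto intro!: continuous_intros simp: ip_scale_left)
      moreover have "ip \<sigma> Pt (monomial p) = 0" "ip \<sigma> t (monomial p) = 0"
        using p False by (auto intro!: Pt_orth t_orth)
      ultimately show "ip \<sigma> (\<lambda>x. t x - Pt x - St x) (monomial p) = 0"
        by (simp add: ip_diff_left continuous_intros)
    qed auto
  qed
  then have "Pt = (\<lambda>x. t x - St x)" by (simp add: fun_eq_iff algebra_simps)
  then have "(\<lambda>x. z x * (w x * \<psi> x) * Pt x)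
      = (\<lambda>x. z x * (w x * \<psi> x) * t x - z x * (w x * \<psi> x) * St x)"
    by (simp add: algebra_simps)
  then have "ip \<sigma> (\<lambda>x. z x * (w x * \<psi> x) * Pt x) ?e
      = ip \<sigma> (\<lambda>x. z x * (w x * \<psi> x) * t x) ?e - ip \<sigma> (\<lambda>x. z x * (w x * \<psi> x) * St x) ?e"
    by (simp only:) (intro ip_diff_left continuous_intros)
  then show ?thesis by (simp only: lhs rhs1 rhs2 1)
qed

end

subsection \<open>From entries to matrices\<close>

lemma mat_adjoint_index:
  assumes "i < dim_col A" "j < dim_row A"
  shows "mat_adjoint A $$ (i, j) = conjugate (A $$ (j, i))"
  using assms by (simp add: mat_adjoint_def mat_of_rows_def)

lemma dim_mat_adjoint [simp]:
  "dim_row (mat_adjoint A) = dim_col A" "dim_col (mat_adjoint A) = dim_row A"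
  by (simp_all add: mat_adjoint_def)

lemma mult_mat_index:
  assumes "i < dim_row A" "j < dim_col B" "dim_col A = dim_row B"
  shows "(A * B) $$ (i, j) = (\<Sum>k<dim_row B. A $$ (i, k) * B $$ (k, j))"
  using assms by (simp add: scalar_prod_def atLeast0LessThan)

text \<open>The vectors list their polynomials by decreasing index; this reversal restores
  increasing order in the sums of matrix products.\<close>

lemma sum_rev: "(\<Sum>k<Suc m. F (m - k)) = (\<Sum>l\<le>m. F l)" for F :: "nat \<Rightarrow> complex"
  using sum.nat_diff_reindex[of F "Suc m"] by (simp add: lessThan_Suc_atMost)

lemma dim_Phi [simp]: "dim_vec (Phi \<sigma> n m) = Suc m" "dim_vec (Phi_tilde \<sigma> n m) = Suc n"
    "dim_vec (rev_Phi \<sigma> n m) = Suc m" "dim_vec (rev_Phi_tilde \<sigma> n m) = Suc n"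
    "dim_vec (z_mult X) = dim_vec X" "dim_vec (w_mult X) = dim_vec X"
  by (simp_all add: Phi_def Phi_tilde_def rev_Phi_def rev_Phi_tilde_def z_mult_def w_mult_def)

lemma dim_vip [simp]: "dim_row (vip \<sigma> X Y) = dim_vec X" "dim_col (vip \<sigma> X Y) = dim_vec Y"
  by (simp_all add: vip_def)

lemma index_Phi:
  "k < Suc m \<Longrightarrow> vec_index (Phi \<sigma> n m) k = phi \<sigma> n m (m - k)"
  "k < Suc n \<Longrightarrow> vec_index (Phi_tilde \<sigma> n m) k = phi_tilde \<sigma> n m (n - k)"
  "k < Suc m \<Longrightarrow> vec_index (rev_Phi \<sigma> n m) k = reverse_poly n m (phi \<sigma> n m (m - k))"
  "k < Suc n \<Longrightarrow> vec_index (rev_Phi_tilde \<sigma> n m) k = reverse_poly n m (phi_tilde \<sigma> n m (n - k))"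
  by (simp_all add: Phi_def Phi_tilde_def rev_Phi_def rev_Phi_tilde_def)

lemma index_mult:
  "k < dim_vec X \<Longrightarrow> vec_index (z_mult X) k = (\<lambda>x. monomial (1, 0) x * vec_index X k x)"
  "k < dim_vec X \<Longrightarrow> vec_index (w_mult X) k = (\<lambda>x. monomial (0, 1) x * vec_index X k x)"
  by (auto simp: z_mult_def w_mult_def)

lemma index_vip:
  "i < dim_vec X \<Longrightarrow> j < dim_vec Y \<Longrightarrow> vip \<sigma> X Y $$ (i, j) = ip \<sigma> (vec_index X i) (vec_index Y j)"
  by (simp add: vip_def)

context bicircle_measure
begin

lemma matrix_identity:
  assumes "n \<ge> 1" "m \<ge> 1"
  shows "mat_adjoint (I_mat \<sigma> (n - 1) m) * E_hat \<sigma> n m * transpose_mat (Gamma1 \<sigma> (n - 1) m)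
    = transpose_mat (K1 \<sigma> n m) * transpose_mat (A_mat \<sigma> n (m - 1))
      - mat_adjoint (Gamma_tilde \<sigma> (n - 1) m) * transpose_mat (K1 \<sigma> (n - 1) m)"
proof -
  obtain N M where nm: "n = Suc N" "m = Suc M"
    using assms by (metis Suc_le_D One_nat_def)
  let ?I = "I_mat \<sigma> N (Suc M)" and ?E = "E_hat \<sigma> (Suc N) (Suc M)" and ?G = "Gamma1 \<sigma> N (Suc M)"
    and ?K = "K1 \<sigma> (Suc N) (Suc M)" and ?A = "A_mat \<sigma> (Suc N) M"
    and ?T = "Gamma_tilde \<sigma> N (Suc M)" and ?L = "K1 \<sigma> N (Suc M)"
  have dims [simp]:
    "dim_row ?I = Suc (Suc M)" "dim_col ?I = Suc N" "dim_row ?E = Suc (Suc M)"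
    "dim_col ?E = Suc (Suc M)" "dim_row ?G = Suc M" "dim_col ?G = Suc (Suc M)"
    "dim_row ?K = Suc M" "dim_col ?K = Suc N" "dim_row ?A = Suc M" "dim_col ?A = Suc M"
    "dim_row ?T = N" "dim_col ?T = Suc N" "dim_row ?L = Suc M" "dim_col ?L = N"
    by (auto simp: I_mat_def E_hat_def Gamma1_def K1_def A_mat_def Gamma_tilde_def)
  have "mat_adjoint ?I * ?E * transpose_mat ?G
      = transpose_mat ?K * transpose_mat ?A - mat_adjoint ?T * transpose_mat ?L"
  proof (rule eq_matI)
    fix i j
    assume "i < dim_row (transpose_mat ?K * transpose_mat ?A - mat_adjoint ?T * transpose_mat ?L)"
      "j < dim_col (transpose_mat ?K * transpose_mat ?A - mat_adjoint ?T * transpose_mat ?L)"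
    then have ij: "i < Suc N" "j < Suc M" by simp_all
    \<comment> \<open>Row \<open>i\<close> and column \<open>j\<close> belong to the polynomial
      indices \<open>N - i\<close> and \<open>M - j\<close> because of the decreasing order.\<close>
    define t where "t = phi_tilde \<sigma> N (Suc M) (N - i)"
    define \<psi> where "\<psi> = phi \<sigma> N M (M - j)"
    let ?\<phi> = "phi \<sigma> N (Suc M)" and ?\<theta> = "phi \<sigma> (Suc N) M" and ?\<eta> = "phi_tilde \<sigma> (N - 1) (Suc M)"
    let ?z = "monomial (1, 0)" and ?w = "monomial (0, 1)"
    have "(mat_adjoint ?I * ?E * transpose_mat ?G) $$ (i, j)
      = (\<Sum>k<Suc (Suc M). (\<Sum>l<Suc (Suc M). conjugate (?I $$ (l, i)) * ?E $$ (l, k)) * ?G $$ (j, k))"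
      using ij by (simp add: mult_mat_index mat_adjoint_index del: index_mult_mat(1) sum.lessThan_Suc)
    also have "\<dots> = (\<Sum>k<Suc (Suc M). (\<Sum>l<Suc (Suc M). cnj (ip \<sigma> (?\<phi> (Suc M - l)) t)
        * ip \<sigma> (\<lambda>x. ?z x * ?\<phi> (Suc M - l) x) (reverse_poly N (Suc M) (?\<phi> (Suc M - k))))
        * ip \<sigma> (\<lambda>x. ?w x * \<psi> x) (?\<phi> (Suc M - k)))"
      using ij by (intro sum.cong refl arg_cong2[where f = "(*)"])
        (simp_all add: I_mat_def E_hat_def Gamma1_def index_vip index_Phi index_mult t_def \<psi>_def)
    also have "\<dots> = (\<Sum>k\<le>Suc M. (\<Sum>l\<le>Suc M. cnj (ip \<sigma> (?\<phi> l) t)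
        * ip \<sigma> (\<lambda>x. ?z x * ?\<phi> l x) (reverse_poly N (Suc M) (?\<phi> k)))
        * ip \<sigma> (\<lambda>x. ?w x * \<psi> x) (?\<phi> k))"
      unfolding sum_rev[where F = "\<lambda>l. cnj (ip \<sigma> (?\<phi> l) t)
        * ip \<sigma> (\<lambda>x. ?z x * ?\<phi> l x) (reverse_poly N (Suc M) (?\<phi> (Suc M - _)))"]
      by (rule sum_rev)
    also note entry_identity[of "N - i" N "M - j" M, folded t_def \<psi>_def]
    also have "(\<Sum>k\<le>M. ip \<sigma> (\<lambda>x. ?w x * ?\<theta> k x) (reverse_poly N (Suc M) t)
        * ip \<sigma> (\<lambda>x. ?z x * \<psi> x) (?\<theta> k)) = (\<Sum>k<Suc M. ?K $$ (k, i) * ?A $$ (j, k))"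
      unfolding sum_rev[symmetric] using ij
      by (intro sum.cong refl arg_cong2[where f = "(*)"])
        (simp_all add: K1_def A_mat_def index_vip index_Phi index_mult t_def \<psi>_def)
    also have "\<dots> = (transpose_mat ?K * transpose_mat ?A) $$ (i, j)"
      using ij by (simp add: mult_mat_index del: index_mult_mat(1) sum.lessThan_Suc)
    also have "(if N = 0 then 0 else \<Sum>k\<le>N - 1. cnj (ip \<sigma> (?\<eta> k) t)
          * ip \<sigma> (\<lambda>x. ?w x * \<psi> x) (reverse_poly (N - 1) (Suc M) (?\<eta> k)))
        = (\<Sum>k<N. conjugate (?T $$ (k, i)) * ?L $$ (j, k))"
    proof (cases N)
      case (Suc N')
      show ?thesis
        unfolding Suc diff_Suc_1 sum_rev[symmetric] using ij
        by (simp del: sum.lessThan_Suc, intro sum.cong refl arg_cong2[where f = "(*)"])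
          (simp_all add: Suc Gamma_tilde_def K1_def index_vip index_Phi index_mult t_def \<psi>_def)
    qed simp
    also have "\<dots> = (mat_adjoint ?T * transpose_mat ?L) $$ (i, j)"
      using ij by (simp add: mult_mat_index mat_adjoint_index del: index_mult_mat(1))
    finally show "(mat_adjoint ?I * ?E * transpose_mat ?G) $$ (i, j)
        = (transpose_mat ?K * transpose_mat ?A - mat_adjoint ?T * transpose_mat ?L) $$ (i, j)"
      using ij by simp
  qed simp_all
  then show ?thesis by (simp add: nm)
qed

section \<open>Recurrence coefficients under the exchange of the variables\<close>

abbreviation swap_vec :: "fvec \<Rightarrow> fvec" where
  "swap_vec \<equiv> map_vec (\<lambda>f. f \<circ> prod.swap)"

lemma Phi_tilde_swap: "Phi_tilde \<sigma> n m = swap_vec (Phi (swap_measure \<sigma>) m n)"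
  by (intro eq_vecI) (simp_all add: Phi_tilde_def Phi_def phi_tilde_eq)

text \<open>This is the preceding equation for the swapped measure, since swapping twice restores
  \<open>\<sigma>\<close>.\<close>

lemma Phi_swap: "Phi \<sigma> n m = swap_vec (Phi_tilde (swap_measure \<sigma>) m n)"
proof -
  interpret swapped: bicircle_measure "swap_measure \<sigma>" by (rule bicircle_measure_swap)
  show ?thesis
    unfolding swapped.Phi_tilde_swap swap_swap_measure by (intro eq_vecI) (auto simp: fun_eq_iff)
qed

lemma vip_swap: "vip \<sigma> (swap_vec X) (swap_vec Y) = vip (swap_measure \<sigma>) X Y"
  by (intro eq_matI) (simp_all add: vip_def ip_swap)

lemma mult_swap: "z_mult (swap_vec X) = swap_vec (w_mult X)" "w_mult (swap_vec X) = swap_vec (z_mult X)"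
  by (intro eq_vecI; auto simp: z_mult_def w_mult_def fun_eq_iff)+

lemma rev_swap:
  "rev_Phi_tilde \<sigma> n m = swap_vec (rev_Phi (swap_measure \<sigma>) m n)"
  "rev_Phi \<sigma> n m = swap_vec (rev_Phi_tilde (swap_measure \<sigma>) m n)"
  unfolding rev_Phi_def rev_Phi_tilde_def Phi_tilde_swap Phi_swap
  by (intro eq_vecI; auto simp: reverse_poly_def fun_eq_iff)+

text \<open>These equations turn the second identity into the first one for the swapped measure,
  with \<open>n\<close> and \<open>m\<close> exchanged.\<close>

lemma coefficients_swap:
  "I_mat_tilde \<sigma> n m = I_mat (swap_measure \<sigma>) m n"
  "E_hat_tilde \<sigma> n m = E_hat (swap_measure \<sigma>) m n"
  "A_tilde \<sigma> n m = A_mat (swap_measure \<sigma>) m n"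
  "K1_tilde \<sigma> n m = K1 (swap_measure \<sigma>) m n"
  "Gamma_mat \<sigma> n m = Gamma_tilde (swap_measure \<sigma>) m n"
  "Gamma1_tilde \<sigma> n m = Gamma1 (swap_measure \<sigma>) m n"
  unfolding I_mat_tilde_def I_mat_def E_hat_tilde_def E_hat_def A_tilde_def A_mat_def
    K1_tilde_def K1_def Gamma_mat_def Gamma_tilde_def Gamma1_tilde_def Gamma1_def
    rev_swap Phi_tilde_swap Phi_swap mult_swap vip_swap
  by auto

end

theorem lemma3p3:
  fixes \<sigma> :: "(complex \<times> complex) measure" and n m :: nat
  assumes "sets \<sigma> = sets (restrict_space borel bicircle)"
    and "finite_measure \<sigma>"
    and "\<And>a b. pos_def_on ({..a} \<times> {..b}) (gram \<sigma>)"
    and "n \<ge> 1" and "m \<ge> 1"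
  shows "(mat_adjoint (I_mat \<sigma> (n - 1) m) * E_hat \<sigma> n m * transpose_mat (Gamma1 \<sigma> (n - 1) m)
       = transpose_mat (K1 \<sigma> n m) * transpose_mat (A_mat \<sigma> n (m - 1))
         - mat_adjoint (Gamma_tilde \<sigma> (n - 1) m) * transpose_mat (K1 \<sigma> (n - 1) m))
       \<and> (mat_adjoint (I_mat_tilde \<sigma> n (m - 1)) * E_hat_tilde \<sigma> n m * transpose_mat (Gamma1_tilde \<sigma> n (m - 1))
       = transpose_mat (K1_tilde \<sigma> n m) * transpose_mat (A_tilde \<sigma> (n - 1) m)
         - mat_adjoint (Gamma_mat \<sigma> n (m - 1)) * transpose_mat (K1_tilde \<sigma> n (m - 1)))"
proof -
  interpret bicircle_measure \<sigma>
    using assms(1-3) by (simp add: bicircle_measure_def bicircle_measure_axioms_def)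
  interpret swapped: bicircle_measure "swap_measure \<sigma>" by (rule bicircle_measure_swap)
  show ?thesis
    unfolding coefficients_swap
    using matrix_identity[OF assms(4,5)] swapped.matrix_identity[OF assms(5,4)] by (rule conjI)
qed

end
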